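(* Let $n$ be a non-negative integer. The ring $\mathcal{S}_n$ becomes a semiquandle under the two binary operations defined, for all $x,y\in\mathcal{S}_n$, by $x\triangleleft_{o}y=s\cdot x+t\cdot y$ and $x\triangleleft_{u}y=s^{-1}(1-t^{2})\cdot x-s^{-1}ts\cdot y$.
   Context: For a non-negative integer $n$, $\mathcal{S}_n$ is the (not necessarily commutative) unital ring obtained as the quotient of the tensor algebra over $\mathbb{Z}$ of the free $\mathbb{Z}$-module with basis $\{s,\overline{s},t\}$ (i.e. the free associative unital ring $\mathbb{Z}\langle s,\overline{s},t\rangle$) by the two-sided ideal $I_n$ generated by $s\overline{s}-1$, $\overline{s}s-1$, $ts-s\sum_{i=1}^{n}t^{i}$, $t\overline{s}-\overline{s}\sum_{i=1}^{n}(-1)^{i-1}t^{i}$ and $t^{n+1}$. The images of $s,\overline{s},t$ are denoted $s,s^{-1},t$. A semiquandle is a set $X$ with two binary operations $(x,y)\mapsto x\triangleleft_{o}y$ and $(x,y)\mapsto x\triangleleft_{u}y$ such that for all $x,y,z\in X$: (0) there are unique $v,w\in X$ with $x=v\triangleleft_{o}y$ and $x=w\triangleleft_{u}y$; (1) $x\triangleleft_{u}y=y$ if and only if $y\triangleleft_{o}x=x$; (2) $(x\triangleleft_{u}y)\triangleleft_{o}(y\triangleleft_{o}x)=x$ and $(x\triangleleft_{o}y)\triangleleft_{u}(y\triangleleft_{u}x)=x$; (3) $(x\triangleleft_{o}y)\triangleleft_{o}z=(x\triangleleft_{o}(z\triangleleft_{u}y))\triangleleft_{o}(y\triangleleft_{o}z)$,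 $(y\triangleleft_{u}x)\triangleleft_{o}(z\triangleleft_{u}(x\triangleleft_{o}y))=(y\triangleleft_{o}z)\triangleleft_{u}(x\triangleleft_{o}(z\triangleleft_{u}y))$, and $(z\triangleleft_{u}(x\triangleleft_{o}y))\triangleleft_{u}(y\triangleleft_{u}x)=(z\triangleleft_{u}y)\triangleleft_{u}x$. *)

theory Defs
  imports
    "HOL-Library.Poly_Mapping"
    "HOL-Algebra.QuotRing"
begin

section \<open>Semiquandles\<close>

locale semiquandle =
  fixes Q :: "'a set"
    and over :: "'a \<Rightarrow> 'a \<Rightarrow> 'a"  (infixl "\<triangleleft>\<^sub>o" 70)
    and under :: "'a \<Rightarrow> 'a \<Rightarrow> 'a"  (infixl "\<triangleleft>\<^sub>u" 70)
  assumes over_closed: "\<lbrakk>x \<in> Q; y \<in> Q\<rbrakk> \<Longrightarrow> x \<triangleleft>\<^sub>o y \<in> Q"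
    and under_closed: "\<lbrakk>x \<in> Q; y \<in> Q\<rbrakk> \<Longrightarrow> x \<triangleleft>\<^sub>u y \<in> Q"
    and over_divisible: "\<lbrakk>x \<in> Q; y \<in> Q\<rbrakk> \<Longrightarrow> \<exists>!v. v \<in> Q \<and> x = v \<triangleleft>\<^sub>o y"
    and under_divisible: "\<lbrakk>x \<in> Q; y \<in> Q\<rbrakk> \<Longrightarrow> \<exists>!w. w \<in> Q \<and> x = w \<triangleleft>\<^sub>u y"
    and fixed_iff: "\<lbrakk>x \<in> Q; y \<in> Q\<rbrakk> \<Longrightarrow> x \<triangleleft>\<^sub>u y = y \<longleftrightarrow> y \<triangleleft>\<^sub>o x = x"
    and over_under_cancel:
      "\<lbrakk>x \<in> Q; y \<in> Q\<rbrakk> \<Longrightarrow> (x \<triangleleft>\<^sub>u y) \<triangleleft>\<^sub>o (y \<triangleleft>\<^sub>o x) = x"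
    and under_over_cancel:
      "\<lbrakk>x \<in> Q; y \<in> Q\<rbrakk> \<Longrightarrow> (x \<triangleleft>\<^sub>o y) \<triangleleft>\<^sub>u (y \<triangleleft>\<^sub>u x) = x"
    and exchange_over:
      "\<lbrakk>x \<in> Q; y \<in> Q; z \<in> Q\<rbrakk> \<Longrightarrow>
        (x \<triangleleft>\<^sub>o y) \<triangleleft>\<^sub>o z = (x \<triangleleft>\<^sub>o (z \<triangleleft>\<^sub>u y)) \<triangleleft>\<^sub>o (y \<triangleleft>\<^sub>o z)"
    and exchange_mixed:
      "\<lbrakk>x \<in> Q; y \<in> Q; z \<in> Q\<rbrakk> \<Longrightarrow>
        (y \<triangleleft>\<^sub>u x) \<triangleleft>\<^sub>o (z \<triangleleft>\<^sub>u (x \<triangleleft>\<^sub>o y)) = (y \<triangleleft>\<^sub>o z) \<triangleleft>\<^sub>u (x \<triangleleft>\<^sub>o (z \<triangleleft>\<^sub>u y))"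
    and exchange_under:
      "\<lbrakk>x \<in> Q; y \<in> Q; z \<in> Q\<rbrakk> \<Longrightarrow>
        (z \<triangleleft>\<^sub>u (x \<triangleleft>\<^sub>o y)) \<triangleleft>\<^sub>u (y \<triangleleft>\<^sub>u x) = (z \<triangleleft>\<^sub>u y) \<triangleleft>\<^sub>u x"


section \<open>The free associative ring on three generators\<close>

datatype generator = Gen_s | Gen_sbar | Gen_t

text \<open>
  Words form the free monoid under concatenation. It is written additively because the
  convolution product on \<^typ>\<open>'a \<Rightarrow>\<^sub>0 'b\<close> is indexed by an (in general noncommutative)
  \<^class>\<open>monoid_add\<close>. The finitely supported integer-valued functions on words are then the
  tensor algebra over the integers of the free module on the letters.
\<close>

datatype word = Word "generator list"

instantiation word :: monoid_add
begin

definition zero_word :: word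
  where "zero_word = Word []"

fun plus_word :: "word \<Rightarrow> word \<Rightarrow> word"
  where "plus_word (Word u) (Word v) = Word (u @ v)"

instance
proof
  fix a b c :: word
  show "a + b + c = a + (b + c)"
    by (cases a; cases b; cases c) simp
  show "0 + a = a" and "a + 0 = a"
    by (cases a; simp add: zero_word_def)+
qed

end

type_synonym free_alg = "word \<Rightarrow>\<^sub>0 int"

definition var :: "generator \<Rightarrow> free_alg"
  where "var g = Poly_Mapping.single (Word [g]) 1"

definition free_ring :: "free_alg ring"
  where "free_ring = \<lparr>carrier = UNIV, mult = (*), one = 1, zero = 0, add = (+)\<rparr>"

lemma ring_free_ring: "ring free_ring"
proof (rule ringI)
  show "abelian_group free_ring"
  proof (rule abelian_groupI)
    fix x assume "x \<in> carrier free_ring"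
    show "\<exists>y\<in>carrier free_ring. y \<oplus>\<^bsub>free_ring\<^esub> x = \<zero>\<^bsub>free_ring\<^esub>"
      by (rule bexI[of _ "- x"]) (simp_all add: free_ring_def)
  qed (simp_all add: free_ring_def ac_simps)
  show "Group.monoid free_ring"
    by (rule monoidI) (simp_all add: free_ring_def mult.assoc)
qed (simp_all add: free_ring_def algebra_simps)


section \<open>The quotient rings\<close>

definition relators :: "nat \<Rightarrow> free_alg set"
  where "relators n =
    (let s = var Gen_s; sbar = var Gen_sbar; t = var Gen_t in
      {s * sbar - 1,
       sbar * s - 1,
       t * s - s * (\<Sum>i=1..n. t ^ i),
       t * sbar - sbar * (\<Sum>i=1..n. (-1) ^ (i - 1) * t ^ i),
       t ^ (n + 1)})"

text \<open>
  In \<open>HOL-Algebra\<close>, \<^locale>\<open>ideal\<close> means two-sided ideal also over noncommutative rings, and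
  \<^const>\<open>genideal\<close> is the smallest such ideal containing a given set.
\<close>

definition relator_ideal :: "nat \<Rightarrow> free_alg set"
  where "relator_ideal n = Idl\<^bsub>free_ring\<^esub> (relators n)"

definition S_ring :: "nat \<Rightarrow> free_alg set ring"
  where "S_ring n = free_ring Quot relator_ideal n"

definition image_of :: "nat \<Rightarrow> generator \<Rightarrow> free_alg set"
  where "image_of n g = relator_ideal n +>\<^bsub>free_ring\<^esub> var g"

abbreviation S_s :: "nat \<Rightarrow> free_alg set"
  where "S_s n \<equiv> image_of n Gen_s"

abbreviation S_sinv :: "nat \<Rightarrow> free_alg set"
  where "S_sinv n \<equiv> image_of n Gen_sbar"

abbreviation S_t :: "nat \<Rightarrow> free_alg set"
  where "S_t n \<equiv> image_of n Gen_t"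

lemma ideal_relator_ideal: "ideal (relator_ideal n) free_ring"
  unfolding relator_ideal_def
  by (rule ring.genideal_ideal[OF ring_free_ring]) (simp add: free_ring_def)

lemma ring_S_ring: "ring (S_ring n)"
  unfolding S_ring_def by (rule ideal.quotient_is_ring[OF ideal_relator_ideal])

lemma image_of_closed: "image_of n g \<in> carrier (S_ring n)"
  unfolding image_of_def S_ring_def FactRing_def
  by (auto simp: A_RCOSETS_def' a_r_coset_def' free_ring_def)

end

theory Submission
  imports Defs
begin

text \<open>
  Over any ring, operations of the form \<open>s x + t y\<close> and \<open>a x - b y\<close> satisfy the semiquandle
  axioms as soon as the coefficients of the variables agree on both sides of each axiom, and
  \<open>s\<close>, \<open>a\<close> and \<open>1 + t\<close> are units: \<open>s\<close> and \<open>a\<close> for unique divisibility, \<open>1 + t\<close> for the fixed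
  point axiom (\<open>linear_semiquandle\<close>).

  Write \<open>r\<close> for the inverse of \<open>s\<close>. The remaining content is that the coefficient identities hold
  for \<open>a = r (1 - t\<^sup>2)\<close> and \<open>b = r t s\<close> (\<open>twisted_semiquandle\<close>). The truncated geometric sum
  \<open>p = t + \<dots> + t\<^sup>n\<close> satisfies \<open>p = t + p t = t + t p\<close> because \<open>t\<^bsup>n+1\<^esup> = 0\<close>; that is, \<open>p\<close> is
  \<open>t / (1 - t)\<close>. The relation \<open>t s = s p\<close> says that conjugation by \<open>s\<close> turns \<open>t\<close> into this
  element, so that \<open>b = p\<close>. Everything follows from these facts. In particular
  \<open>(1 - t) r (1 + t) = r\<close>, hence \<open>1 + t\<close> is invertible with inverse \<open>s (1 - t) r\<close>, while \<open>1 - t\<close> is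
  invertible with inverse \<open>1 + p\<close>, and \<open>a = r (1 - t) (1 + t)\<close> is a product of units; in fact it is
  the conjugate \<open>(1 - t)\<^sup>-\<^sup>1 r (1 - t)\<close> of \<open>r\<close>.

  The computations avoid subtraction throughout: \<open>a x - b y = w\<close> is always replaced by
  \<open>a x = w + b y\<close>, and \<open>a\<close> enters the coefficient identities only through \<open>a + r t\<^sup>2 = r\<close>.
  In this form every step is a rearrangement of sums or the cancellation of a common summand.
\<close>

section \<open>Linear semiquandles over a ring\<close>

lemma (in ring) minus_eq_iff_eq_add:
  assumes "x \<in> carrier R" "y \<in> carrier R" "z \<in> carrier R"
  shows "x \<ominus> y = z \<longleftrightarrow> x = z \<oplus> y"
  using assms by (metis a_minus_def a_assoc a_inv_closed l_neg r_neg r_zero)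

lemma (in ring) unique_linear_solution:
  assumes "a \<in> Units R" "x \<in> carrier R" "c \<in> carrier R"
  shows "\<exists>!v. v \<in> carrier R \<and> x = a \<otimes> v \<oplus> c"
proof (rule ex1I)
  have a: "a \<in> carrier R" using assms by blast
  show "inv a \<otimes> (x \<ominus> c) \<in> carrier R \<and> x = a \<otimes> (inv a \<otimes> (x \<ominus> c)) \<oplus> c"
    using assms a by (simp add: m_assoc[symmetric] minus_eq_iff_eq_add[symmetric])
  fix v assume v: "v \<in> carrier R \<and> x = a \<otimes> v \<oplus> c"
  then have "x \<ominus> c = a \<otimes> v" using assms a by (simp add: minus_eq_iff_eq_add)
  then show "v = inv a \<otimes> (x \<ominus> c)"
    using assms a v by (simp add: m_assoc[symmetric])
qed

text \<open>
  Each hypothesis from \<open>sb\<close> on compares the coefficients of one variable in one axiom: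
  \<open>sb\<close>, \<open>sa\<close>, \<open>as\<close> and \<open>at\<close> come from the two cancellation axioms, \<open>ts\<close> and \<open>sta\<close> from the first
  exchange axiom, \<open>sa_as\<close>, \<open>bs\<close> and \<open>ta\<close> from the mixed one, and \<open>abs\<close> and \<open>ab\<close> from the last one.
  The fixed point axiom holds because \<open>s (a x - y - b y) = (1 + t) (x - (s y + t x))\<close> with
  \<open>s\<close> and \<open>1 + t\<close> invertible.
\<close>

lemma (in ring) linear_semiquandle:
  assumes s: "s \<in> Units R" and a: "a \<in> Units R" and t1: "\<one> \<oplus> t \<in> Units R"
    and t: "t \<in> carrier R" and b: "b \<in> carrier R"
    and sb: "s \<otimes> b = t \<otimes> s"
    and sa: "s \<otimes> a \<oplus> t \<otimes> t = \<one>"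
    and as: "a \<otimes> s \<oplus> b \<otimes> b = \<one>"
    and at: "a \<otimes> t = b \<otimes> a"
    and ts: "t \<otimes> s = s \<otimes> t \<oplus> s \<otimes> t \<otimes> b"
    and sta: "s \<otimes> t \<otimes> a \<oplus> t \<otimes> t = t"
    and sa_as: "s \<otimes> a = a \<otimes> s \<oplus> b \<otimes> t \<otimes> b \<oplus> t \<otimes> b \<otimes> t"
    and bs: "s \<otimes> b \<oplus> t \<otimes> b \<otimes> s = b \<otimes> s"
    and ta: "t \<otimes> a \<oplus> b \<otimes> t \<otimes> a = a \<otimes> t"
    and abs: "a \<otimes> b \<otimes> s = b \<oplus> b \<otimes> b"
    and ab: "a \<otimes> b = a \<otimes> b \<otimes> t \<oplus> b \<otimes> a"
  shows "semiquandle (carrier R) (\<lambda>x y. s \<otimes> x \<oplus> t \<otimes> y) (\<lambda>x y. a \<otimes> x \<ominus> b \<otimes> y)"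
proof -
  define under where "under x y = a \<otimes> x \<ominus> b \<otimes> y" for x y
  have car[simp]: "s \<in> carrier R" "a \<in> carrier R" "t \<in> carrier R" "b \<in> carrier R"
    using s a t b by auto
  have under_closed[simp]: "under x y \<in> carrier R" if "x \<in> carrier R" "y \<in> carrier R" for x y
    using that by (simp add: under_def)
  have under_iff: "under x y = w \<longleftrightarrow> a \<otimes> x = w \<oplus> b \<otimes> y"
    if "x \<in> carrier R" "y \<in> carrier R" "w \<in> carrier R" for x y w
    using that by (simp add: under_def minus_eq_iff_eq_add)
  have under_add: "a \<otimes> x = under x y \<oplus> b \<otimes> y" if "x \<in> carrier R" "y \<in> carrier R" for x y
    using that under_iff[of x y "under x y"] by simp
  note exp = r_distr l_distr m_assoc a_assoc a_comm a_lcomm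
  (* The coefficient identities applied to a ring element, associated to the right so that
     they match fully expanded expressions. *)
  have sb': "s \<otimes> (b \<otimes> x) = t \<otimes> (s \<otimes> x)" if "x \<in> carrier R" for x
    using that arg_cong[OF sb, of "\<lambda>c. c \<otimes> x"] by (simp add: l_distr m_assoc)
  have sa': "s \<otimes> (a \<otimes> x) \<oplus> t \<otimes> (t \<otimes> x) = x" if "x \<in> carrier R" for x
    using that arg_cong[OF sa, of "\<lambda>c. c \<otimes> x"] by (simp add: l_distr m_assoc)
  have as': "a \<otimes> (s \<otimes> x) \<oplus> b \<otimes> (b \<otimes> x) = x" if "x \<in> carrier R" for x
    using that arg_cong[OF as, of "\<lambda>c. c \<otimes> x"] by (simp add: l_distr m_assoc)
  have at': "a \<otimes> (t \<otimes> x) = b \<otimes> (a \<otimes> x)" if "x \<in> carrier R" for x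
    using that arg_cong[OF at, of "\<lambda>c. c \<otimes> x"] by (simp add: l_distr m_assoc)
  have ts': "t \<otimes> (s \<otimes> x) = s \<otimes> (t \<otimes> x) \<oplus> s \<otimes> (t \<otimes> (b \<otimes> x))" if "x \<in> carrier R" for x
    using that arg_cong[OF ts, of "\<lambda>c. c \<otimes> x"] by (simp add: l_distr m_assoc)
  have sta': "s \<otimes> (t \<otimes> (a \<otimes> x)) \<oplus> t \<otimes> (t \<otimes> x) = t \<otimes> x" if "x \<in> carrier R" for x
    using that arg_cong[OF sta, of "\<lambda>c. c \<otimes> x"] by (simp add: l_distr m_assoc)
  have sa_as': "s \<otimes> (a \<otimes> x) = a \<otimes> (s \<otimes> x) \<oplus> b \<otimes> (t \<otimes> (b \<otimes> x)) \<oplus> t \<otimes> (b \<otimes> (t \<otimes> x))"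
    if "x \<in> carrier R" for x
    using that arg_cong[OF sa_as, of "\<lambda>c. c \<otimes> x"] by (simp add: l_distr m_assoc)
  have bs': "s \<otimes> (b \<otimes> x) \<oplus> t \<otimes> (b \<otimes> (s \<otimes> x)) = b \<otimes> (s \<otimes> x)" if "x \<in> carrier R" for x
    using that arg_cong[OF bs, of "\<lambda>c. c \<otimes> x"] by (simp add: l_distr m_assoc)
  have ta': "t \<otimes> (a \<otimes> x) \<oplus> b \<otimes> (t \<otimes> (a \<otimes> x)) = a \<otimes> (t \<otimes> x)" if "x \<in> carrier R" for x
    using that arg_cong[OF ta, of "\<lambda>c. c \<otimes> x"] by (simp add: l_distr m_assoc)
  have abs': "a \<otimes> (b \<otimes> (s \<otimes> x)) = b \<otimes> x \<oplus> b \<otimes> (b \<otimes> x)" if "x \<in> carrier R" for x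
    using that arg_cong[OF abs, of "\<lambda>c. c \<otimes> x"] by (simp add: l_distr m_assoc)
  have ab': "a \<otimes> (b \<otimes> x) = a \<otimes> (b \<otimes> (t \<otimes> x)) \<oplus> b \<otimes> (a \<otimes> x)" if "x \<in> carrier R" for x
    using that arg_cong[OF ab, of "\<lambda>c. c \<otimes> x"] by (simp add: l_distr m_assoc)
  have "semiquandle (carrier R) (\<lambda>x y. s \<otimes> x \<oplus> t \<otimes> y) under"
  proof
    fix x y assume x[simp]: "x \<in> carrier R" and y[simp]: "y \<in> carrier R"
    show "s \<otimes> x \<oplus> t \<otimes> y \<in> carrier R" by simp
    show "under x y \<in> carrier R" by simp
    show "\<exists>!v. v \<in> carrier R \<and> x = s \<otimes> v \<oplus> t \<otimes> y"
      using unique_linear_solution[OF s] by simp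
    show "\<exists>!w. w \<in> carrier R \<and> x = under w y"
      using unique_linear_solution[OF a, of x "\<ominus> (b \<otimes> y)"] by (simp add: under_def a_minus_def)
    let ?v = "s \<otimes> y \<oplus> t \<otimes> x"
    have "under x y = y \<longleftrightarrow> y \<oplus> b \<otimes> y = a \<otimes> x"
      by (subst under_iff) auto
    also have "\<dots> \<longleftrightarrow> s \<otimes> (y \<oplus> b \<otimes> y) = s \<otimes> (a \<otimes> x)"
      using Units_l_cancel[OF s] by simp
    (* Adding t t x + t x makes both sides multiples of 1 + t. *)
    also have "\<dots> \<longleftrightarrow> s \<otimes> (y \<oplus> b \<otimes> y) \<oplus> t \<otimes> (t \<otimes> x) \<oplus> t \<otimes> x
                    = s \<otimes> (a \<otimes> x) \<oplus> t \<otimes> (t \<otimes> x) \<oplus> t \<otimes> x"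
      by (simp add: add.right_cancel)
    also have "s \<otimes> (a \<otimes> x) \<oplus> t \<otimes> (t \<otimes> x) \<oplus> t \<otimes> x = (\<one> \<oplus> t) \<otimes> x"
      by (simp only: sa' x) (simp add: l_distr)
    also have "s \<otimes> (y \<oplus> b \<otimes> y) \<oplus> t \<otimes> (t \<otimes> x) \<oplus> t \<otimes> x = (\<one> \<oplus> t) \<otimes> ?v"
      by (simp add: exp sb')
    also have "(\<one> \<oplus> t) \<otimes> ?v = (\<one> \<oplus> t) \<otimes> x \<longleftrightarrow> ?v = x"
      using Units_l_cancel[OF t1] by simp
    finally show "under x y = y \<longleftrightarrow> ?v = x" .
    have "x = s \<otimes> (under x y \<oplus> b \<otimes> y) \<oplus> t \<otimes> (t \<otimes> x)"
      by (simp add: under_add[symmetric] sa')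
    then show "s \<otimes> under x y \<oplus> t \<otimes> (s \<otimes> y \<oplus> t \<otimes> x) = x"
      by (simp add: r_distr a_assoc sb')
    have "a \<otimes> (s \<otimes> x \<oplus> t \<otimes> y) = a \<otimes> (s \<otimes> x) \<oplus> b \<otimes> (under y x \<oplus> b \<otimes> x)"
      by (simp add: under_add[symmetric] at' r_distr)
    also have "\<dots> = (a \<otimes> (s \<otimes> x) \<oplus> b \<otimes> (b \<otimes> x)) \<oplus> b \<otimes> under y x"
      by (simp add: exp)
    finally show "under (s \<otimes> x \<oplus> t \<otimes> y) (under y x) = x"
      by (simp add: under_iff as')
  next
    fix x y z assume x[simp]: "x \<in> carrier R" and y[simp]: "y \<in> carrier R" and z[simp]: "z \<in> carrier R"
    (* The element a z has two decompositions, through u and through w. The second and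
       third exchange axioms result from choosing the right one for each occurrence of a z. *)
    define u where "u = under z y"
    define v where "v = under y x"
    define w where "w = under z (s \<otimes> x \<oplus> t \<otimes> y)"
    have [simp]: "u \<in> carrier R" "v \<in> carrier R" "w \<in> carrier R"
      by (auto simp: u_def v_def w_def)
    have u: "a \<otimes> z = u \<oplus> b \<otimes> y" and v: "a \<otimes> y = v \<oplus> b \<otimes> x"
      and w: "a \<otimes> z = w \<oplus> b \<otimes> (s \<otimes> x \<oplus> t \<otimes> y)"
      by (auto simp: u_def v_def w_def under_add[symmetric])
    have "t \<otimes> z = s \<otimes> (t \<otimes> (u \<oplus> b \<otimes> y)) \<oplus> t \<otimes> (t \<otimes> z)"
      by (simp add: u[symmetric] sta')
    then have "s \<otimes> (s \<otimes> x \<oplus> t \<otimes> y) \<oplus> t \<otimes> z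
        = s \<otimes> (s \<otimes> x \<oplus> t \<otimes> y) \<oplus> (s \<otimes> (t \<otimes> (u \<oplus> b \<otimes> y)) \<oplus> t \<otimes> (t \<otimes> z))"
      by simp
    also have "\<dots> = s \<otimes> (s \<otimes> x \<oplus> t \<otimes> u) \<oplus> t \<otimes> (s \<otimes> y \<oplus> t \<otimes> z)"
      by (simp add: exp ts')
    finally show "s \<otimes> (s \<otimes> x \<oplus> t \<otimes> y) \<oplus> t \<otimes> z
        = s \<otimes> (s \<otimes> x \<oplus> t \<otimes> under z y) \<oplus> t \<otimes> (s \<otimes> y \<oplus> t \<otimes> z)"
      by (simp only: u_def)
    have "a \<otimes> (s \<otimes> y \<oplus> t \<otimes> z) = a \<otimes> (s \<otimes> y) \<oplus> (t \<otimes> (a \<otimes> z) \<oplus> b \<otimes> (t \<otimes> (a \<otimes> z)))"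
      by (simp add: ta' r_distr)
    also have "\<dots> = a \<otimes> (s \<otimes> y) \<oplus>
        (t \<otimes> (w \<oplus> b \<otimes> (s \<otimes> x \<oplus> t \<otimes> y)) \<oplus> b \<otimes> (t \<otimes> (u \<oplus> b \<otimes> y)))"
      by (simp only: u[symmetric] w[symmetric])
    also have "\<dots> = (a \<otimes> (s \<otimes> y) \<oplus> b \<otimes> (t \<otimes> (b \<otimes> y)) \<oplus> t \<otimes> (b \<otimes> (t \<otimes> y)))
        \<oplus> t \<otimes> w \<oplus> b \<otimes> (t \<otimes> u) \<oplus> t \<otimes> (b \<otimes> (s \<otimes> x))"
      by (simp add: exp)
    also have "\<dots> = s \<otimes> (v \<oplus> b \<otimes> x) \<oplus> t \<otimes> w \<oplus> b \<otimes> (t \<otimes> u) \<oplus> t \<otimes> (b \<otimes> (s \<otimes> x))"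
      by (simp only: sa_as'[OF y, symmetric] v)
    also have "\<dots> = s \<otimes> v \<oplus> t \<otimes> w \<oplus> b \<otimes> (t \<otimes> u) \<oplus> (s \<otimes> (b \<otimes> x) \<oplus> t \<otimes> (b \<otimes> (s \<otimes> x)))"
      by (simp add: exp)
    also have "\<dots> = s \<otimes> v \<oplus> t \<otimes> w \<oplus> b \<otimes> (s \<otimes> x \<oplus> t \<otimes> u)"
      by (simp only: bs' x) (simp add: exp)
    finally have "under (s \<otimes> y \<oplus> t \<otimes> z) (s \<otimes> x \<oplus> t \<otimes> u) = s \<otimes> v \<oplus> t \<otimes> w"
      by (simp add: under_iff)
    then show "s \<otimes> under y x \<oplus> t \<otimes> under z (s \<otimes> x \<oplus> t \<otimes> y)
        = under (s \<otimes> y \<oplus> t \<otimes> z) (s \<otimes> x \<oplus> t \<otimes> under z y)"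
      by (simp only: u_def v_def w_def)
    define q where "q = under u x"
    have [simp]: "q \<in> carrier R" by (simp add: q_def)
    have q: "a \<otimes> u = q \<oplus> b \<otimes> x" by (simp add: q_def under_add[symmetric])
    (* The terms left over once both sides of the last axiom are expanded; they cancel. *)
    let ?c = "b \<otimes> x \<oplus> b \<otimes> (b \<otimes> x) \<oplus> a \<otimes> (b \<otimes> (t \<otimes> y))"
    have "a \<otimes> w \<oplus> ?c = a \<otimes> (w \<oplus> b \<otimes> (s \<otimes> x \<oplus> t \<otimes> y))"
      by (simp add: exp abs')
    also have "\<dots> = a \<otimes> (u \<oplus> b \<otimes> y)" by (simp only: u[symmetric] w[symmetric])
    also have "\<dots> = (q \<oplus> b \<otimes> x) \<oplus> (a \<otimes> (b \<otimes> (t \<otimes> y)) \<oplus> b \<otimes> (v \<oplus> b \<otimes> x))"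
      by (simp only: q[symmetric] v[symmetric] ab'[OF y, symmetric]) (simp add: r_distr)
    also have "\<dots> = (q \<oplus> b \<otimes> v) \<oplus> ?c"
      by (simp add: exp)
    finally have "a \<otimes> w = q \<oplus> b \<otimes> v"
      by (simp add: add.right_cancel)
    then have "under w v = q" by (simp add: under_iff)
    then show "under (under z (s \<otimes> x \<oplus> t \<otimes> y)) (under y x) = under (under z y) x"
      by (simp only: u_def v_def w_def q_def)
  qed
  then show ?thesis by (simp only: under_def[abs_def])
qed

section \<open>Twisting by a unit\<close>

text \<open>
  The hypotheses say that \<open>p\<close> is the quasi-inverse \<open>t / (1 - t)\<close> of \<open>t\<close> and the conjugate of \<open>t\<close>
  by the unit \<open>s\<close>. Moving \<open>s\<close> or \<open>r\<close> past \<open>t\<close> by this rule and absorbing the result with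
  \<open>p = t + p t = t + t p\<close> yields all the coefficient identities. The basic
  ones that involve \<open>a\<close> are obtained by adding a multiple of \<open>r t\<^sup>2\<close> to both sides, which turns
  \<open>a\<close> into \<open>r\<close>; the others follow from these.
\<close>

lemma (in ring) twisted_semiquandle:
  assumes s[simp]: "s \<in> carrier R" and r[simp]: "r \<in> carrier R"
    and t[simp]: "t \<in> carrier R" and p[simp]: "p \<in> carrier R"
    and sr: "s \<otimes> r = \<one>" and rs: "r \<otimes> s = \<one>"
    and ts: "t \<otimes> s = s \<otimes> p"
    and pt: "p = t \<oplus> p \<otimes> t" and tp: "p = t \<oplus> t \<otimes> p"
  shows "semiquandle (carrier R) (\<lambda>x y. s \<otimes> x \<oplus> t \<otimes> y)
    (\<lambda>x y. (r \<otimes> (\<one> \<ominus> t [^] (2::nat))) \<otimes> x \<ominus> (r \<otimes> t \<otimes> s) \<otimes> y)"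
proof -
  define a where "a = r \<otimes> (\<one> \<ominus> t \<otimes> t)"
  have [simp]: "a \<in> carrier R" by (simp add: a_def)
  have cancel: "x = y" if "x \<oplus> z = y \<oplus> z" "x \<in> carrier R" "y \<in> carrier R" "z \<in> carrier R" for x y z
    using that by (simp add: add.right_cancel)
  have rts: "r \<otimes> t \<otimes> s = p"
    by (simp add: m_assoc ts) (simp add: m_assoc[symmetric] rs)
  have a_add: "a \<oplus> r \<otimes> t \<otimes> t = r"
  proof -
    have "a \<oplus> r \<otimes> t \<otimes> t = r \<otimes> ((\<one> \<ominus> t \<otimes> t) \<oplus> t \<otimes> t)"
      by (simp add: a_def r_distr m_assoc)
    also have "(\<one> \<ominus> t \<otimes> t) \<oplus> t \<otimes> t = \<one>"
      using minus_eq_iff_eq_add[of \<one> "t \<otimes> t" "\<one> \<ominus> t \<otimes> t"] by simp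
    finally show ?thesis by simp
  qed
  have rt: "r \<otimes> t = p \<otimes> r"
    by (metis rts m_assoc r s t m_closed sr r_one)
  have comm: "p \<otimes> t = t \<otimes> p"
    by (rule cancel[where z = t]) (simp_all add: a_comm pt[symmetric] tp[symmetric])
  (* This and the next identity say (1 - t) r (1 + t) = r and (1 + t) s (1 - t) = s. *)
  have rt_tr: "r \<otimes> t = t \<otimes> r \<oplus> t \<otimes> r \<otimes> t"
  proof -
    have "r \<otimes> t = (t \<oplus> t \<otimes> p) \<otimes> r" by (simp only: rt tp[symmetric])
    also have "\<dots> = t \<otimes> r \<oplus> t \<otimes> (p \<otimes> r)" by (simp add: l_distr m_assoc)
    finally show ?thesis by (simp add: rt[symmetric] m_assoc)
  qed
  have ts_st: "t \<otimes> s = s \<otimes> t \<oplus> t \<otimes> s \<otimes> t"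
  proof -
    have "t \<otimes> s = s \<otimes> (t \<oplus> p \<otimes> t)" by (simp only: ts pt[symmetric])
    also have "\<dots> = s \<otimes> t \<oplus> s \<otimes> p \<otimes> t" by (simp add: r_distr m_assoc)
    finally show ?thesis by (simp add: ts[symmetric])
  qed
  have s_unit: "s \<in> Units R" and r_unit: "r \<in> Units R"
    using sr rs by (auto simp: Units_def)
  have at: "a \<otimes> t = p \<otimes> a"
  proof (rule cancel[where z = "r \<otimes> t \<otimes> t \<otimes> t"])
    have "a \<otimes> t \<oplus> r \<otimes> t \<otimes> t \<otimes> t = r \<otimes> t"
      by (subst a_add[symmetric], subst l_distr) auto
    moreover have "p \<otimes> a \<oplus> p \<otimes> r \<otimes> t \<otimes> t = p \<otimes> r"
      by (subst (2) a_add[symmetric]) (simp add: r_distr m_assoc)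
    ultimately show "a \<otimes> t \<oplus> r \<otimes> t \<otimes> t \<otimes> t = p \<otimes> a \<oplus> r \<otimes> t \<otimes> t \<otimes> t"
      by (simp add: rt)
  qed simp_all
  have sa: "s \<otimes> a \<oplus> t \<otimes> t = \<one>"
  proof -
    have "s \<otimes> a \<oplus> (s \<otimes> r) \<otimes> (t \<otimes> t) = s \<otimes> (a \<oplus> r \<otimes> t \<otimes> t)"
      by (simp add: r_distr m_assoc)
    then show ?thesis by (simp add: a_add sr)
  qed
  have as: "a \<otimes> s \<oplus> p \<otimes> p = \<one>"
  proof -
    have "p \<otimes> p = p \<otimes> (r \<otimes> t \<otimes> s)" by (simp add: rts)
    also have "\<dots> = (p \<otimes> r) \<otimes> t \<otimes> s" by (simp add: m_assoc)
    finally have "a \<otimes> s \<oplus> p \<otimes> p = (a \<oplus> r \<otimes> t \<otimes> t) \<otimes> s"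
      by (simp add: rt[symmetric] l_distr)
    then show ?thesis by (simp add: a_add rs)
  qed
  have sta: "s \<otimes> t \<otimes> a \<oplus> t \<otimes> t = t"
  proof -
    have str: "t = s \<otimes> (t \<otimes> r) \<oplus> s \<otimes> (t \<otimes> r) \<otimes> t"
    proof -
      have "s \<otimes> (t \<otimes> r) \<oplus> s \<otimes> (t \<otimes> r) \<otimes> t = s \<otimes> (r \<otimes> t)"
        by (subst rt_tr) (simp add: r_distr m_assoc)
      also have "\<dots> = t" by (simp add: m_assoc[symmetric] sr)
      finally show ?thesis by simp
    qed
    have "s \<otimes> t \<otimes> a \<oplus> t \<otimes> t
        = s \<otimes> t \<otimes> a \<oplus> (s \<otimes> (t \<otimes> r) \<oplus> s \<otimes> (t \<otimes> r) \<otimes> t) \<otimes> t"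
      by (simp only: str[symmetric])
    also have "\<dots> = s \<otimes> t \<otimes> (a \<oplus> r \<otimes> t \<otimes> t) \<oplus> s \<otimes> (t \<otimes> r) \<otimes> t"
      by (simp add: r_distr l_distr m_assoc a_ac)
    also have "\<dots> = t"
      by (simp only: a_add) (simp add: m_assoc str[symmetric, simplified m_assoc s t r m_closed])
    finally show ?thesis .
  qed
  define d where "d = \<one> \<ominus> t"
  have [simp]: "d \<in> carrier R" by (simp add: d_def)
  have d_add: "d \<oplus> t = \<one>"
    using minus_eq_iff_eq_add[of \<one> t d] by (simp add: d_def)
  have d_unit: "d \<in> Units R"
  proof -
    have "(\<one> \<oplus> p) \<otimes> d = \<one>"
    proof (rule cancel[where z = "(\<one> \<oplus> p) \<otimes> t"])
      have "(\<one> \<oplus> p) \<otimes> d \<oplus> (\<one> \<oplus> p) \<otimes> t = \<one> \<oplus> p"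
        by (simp add: r_distr[symmetric] d_add)
      then show "(\<one> \<oplus> p) \<otimes> d \<oplus> (\<one> \<oplus> p) \<otimes> t = \<one> \<oplus> (\<one> \<oplus> p) \<otimes> t"
        by (simp add: l_distr pt[symmetric])
    qed simp_all
    moreover have "d \<otimes> (\<one> \<oplus> p) = \<one>"
    proof (rule cancel[where z = "t \<otimes> (\<one> \<oplus> p)"])
      have "d \<otimes> (\<one> \<oplus> p) \<oplus> t \<otimes> (\<one> \<oplus> p) = \<one> \<oplus> p"
        by (simp add: l_distr[symmetric] d_add)
      then show "d \<otimes> (\<one> \<oplus> p) \<oplus> t \<otimes> (\<one> \<oplus> p) = \<one> \<oplus> t \<otimes> (\<one> \<oplus> p)"
        by (simp add: r_distr tp[symmetric])
    qed simp_all
    ultimately show ?thesis unfolding Units_def by auto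
  qed
  have one_plus: "\<one> \<oplus> t \<in> Units R"
  proof -
    have "(s \<otimes> d \<otimes> r) \<otimes> (\<one> \<oplus> t) = \<one>"
    proof (rule cancel[where z = "(s \<otimes> t \<otimes> r) \<otimes> (\<one> \<oplus> t)"])
      have "(s \<otimes> d \<otimes> r) \<otimes> (\<one> \<oplus> t) \<oplus> (s \<otimes> t \<otimes> r) \<otimes> (\<one> \<oplus> t) = (s \<otimes> (d \<oplus> t) \<otimes> r) \<otimes> (\<one> \<oplus> t)"
        by (simp add: l_distr r_distr m_assoc a_ac)
      also have "\<dots> = \<one> \<oplus> s \<otimes> (r \<otimes> t)"
        by (simp add: d_add sr m_assoc[of s r t, symmetric])
      also have "\<dots> = \<one> \<oplus> (s \<otimes> t \<otimes> r) \<otimes> (\<one> \<oplus> t)"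
        by (subst rt_tr) (simp add: r_distr m_assoc)
      finally show "(s \<otimes> d \<otimes> r) \<otimes> (\<one> \<oplus> t) \<oplus> (s \<otimes> t \<otimes> r) \<otimes> (\<one> \<oplus> t)
          = \<one> \<oplus> (s \<otimes> t \<otimes> r) \<otimes> (\<one> \<oplus> t)" .
    qed simp_all
    moreover have "(\<one> \<oplus> t) \<otimes> (s \<otimes> d \<otimes> r) = \<one>"
    proof (rule cancel[where z = "(\<one> \<oplus> t) \<otimes> (s \<otimes> t \<otimes> r)"])
      have "(\<one> \<oplus> t) \<otimes> (s \<otimes> d \<otimes> r) \<oplus> (\<one> \<oplus> t) \<otimes> (s \<otimes> t \<otimes> r) = (\<one> \<oplus> t) \<otimes> (s \<otimes> (d \<oplus> t) \<otimes> r)"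
        by (simp add: l_distr r_distr m_assoc a_ac)
      also have "\<dots> = \<one> \<oplus> (t \<otimes> s) \<otimes> r"
        by (simp add: d_add sr m_assoc)
      also have "\<dots> = \<one> \<oplus> (\<one> \<oplus> t) \<otimes> (s \<otimes> t \<otimes> r)"
        by (subst ts_st) (simp add: l_distr m_assoc)
      finally show "(\<one> \<oplus> t) \<otimes> (s \<otimes> d \<otimes> r) \<oplus> (\<one> \<oplus> t) \<otimes> (s \<otimes> t \<otimes> r)
          = \<one> \<oplus> (\<one> \<oplus> t) \<otimes> (s \<otimes> t \<otimes> r)" .
    qed simp_all
    ultimately show ?thesis unfolding Units_def by auto
  qed
  have "\<one> \<ominus> t \<otimes> t = d \<otimes> (\<one> \<oplus> t)"
  proof -
    have "d \<otimes> (\<one> \<oplus> t) \<oplus> t \<otimes> t = d \<oplus> (d \<oplus> t) \<otimes> t"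
      by (simp add: r_distr l_distr a_assoc)
    then show ?thesis by (simp add: d_add minus_eq_iff_eq_add)
  qed
  then have a_unit: "a \<in> Units R"
    using r_unit d_unit one_plus by (simp add: a_def)
  have "semiquandle (carrier R) (\<lambda>x y. s \<otimes> x \<oplus> t \<otimes> y) (\<lambda>x y. a \<otimes> x \<ominus> p \<otimes> y)"
  proof (rule linear_semiquandle)
    show "s \<otimes> p = t \<otimes> s" by (rule ts[symmetric])
    show "t \<otimes> s = s \<otimes> t \<oplus> s \<otimes> t \<otimes> p"
      using ts_st by (simp add: ts m_assoc comm)
    (* Both sides become 1 after adding t t, since p p = (t + t p) t + p t p. *)
    have "s \<otimes> a \<oplus> t \<otimes> t = (a \<otimes> s \<oplus> p \<otimes> t \<otimes> p \<oplus> t \<otimes> p \<otimes> t) \<oplus> t \<otimes> t"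
    proof -
      have "p \<otimes> p = p \<otimes> (t \<oplus> t \<otimes> p)" by (simp only: tp[symmetric])
      also have "\<dots> = p \<otimes> t \<oplus> p \<otimes> t \<otimes> p"
        by (simp add: r_distr m_assoc)
      also have "\<dots> = (t \<oplus> t \<otimes> p) \<otimes> t \<oplus> p \<otimes> t \<otimes> p"
        by (simp only: tp[symmetric])
      also have "\<dots> = p \<otimes> t \<otimes> p \<oplus> t \<otimes> p \<otimes> t \<oplus> t \<otimes> t"
        by (simp add: l_distr a_ac)
      finally show ?thesis using sa as by (simp add: a_ac)
    qed
    then show "s \<otimes> a = a \<otimes> s \<oplus> p \<otimes> t \<otimes> p \<oplus> t \<otimes> p \<otimes> t"
      by (rule cancel) simp_all
    have "s \<otimes> p \<oplus> t \<otimes> p \<otimes> s = (t \<oplus> t \<otimes> p) \<otimes> s"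
      by (simp add: ts l_distr)
    then show "s \<otimes> p \<oplus> t \<otimes> p \<otimes> s = p \<otimes> s" by (simp only: tp[symmetric])
    have "t \<otimes> a \<oplus> p \<otimes> t \<otimes> a = (t \<oplus> p \<otimes> t) \<otimes> a" by (simp add: l_distr)
    then show "t \<otimes> a \<oplus> p \<otimes> t \<otimes> a = a \<otimes> t" by (simp only: pt[symmetric] at)
    have "a \<otimes> p = a \<otimes> (t \<oplus> p \<otimes> t)" by (simp only: pt[symmetric])
    also have "\<dots> = a \<otimes> p \<otimes> t \<oplus> p \<otimes> a"
      by (simp add: r_distr m_assoc at a_comm)
    finally show "a \<otimes> p = a \<otimes> p \<otimes> t \<oplus> p \<otimes> a" .
    have rps: "r \<otimes> p \<otimes> s = p \<oplus> p \<otimes> (r \<otimes> p \<otimes> s)"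
    proof -
      have "r \<otimes> p \<otimes> s = r \<otimes> (t \<oplus> t \<otimes> p) \<otimes> s" by (simp only: tp[symmetric])
      also have "\<dots> = r \<otimes> t \<otimes> s \<oplus> (r \<otimes> t) \<otimes> p \<otimes> s"
        by (simp add: r_distr l_distr m_assoc)
      also have "\<dots> = p \<oplus> p \<otimes> (r \<otimes> p \<otimes> s)"
        by (simp only: rts, simp only: rt, simp add: m_assoc)
      finally show ?thesis .
    qed
    show "a \<otimes> p \<otimes> s = p \<oplus> p \<otimes> p"
    proof (rule cancel[where z = "r \<otimes> t \<otimes> t \<otimes> p \<otimes> s"])
      have "a \<otimes> p \<otimes> s \<oplus> r \<otimes> t \<otimes> t \<otimes> p \<otimes> s = (a \<oplus> r \<otimes> t \<otimes> t) \<otimes> p \<otimes> s"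
        by (simp add: l_distr)
      also have "\<dots> = p \<oplus> p \<otimes> (p \<oplus> p \<otimes> (r \<otimes> p \<otimes> s))"
        by (simp only: a_add rps[symmetric])
      also have "\<dots> = p \<oplus> p \<otimes> p \<oplus> p \<otimes> (p \<otimes> r) \<otimes> p \<otimes> s"
        by (simp add: r_distr m_assoc a_assoc)
      also have "p \<otimes> (p \<otimes> r) = r \<otimes> t \<otimes> t"
        by (metis rt m_assoc p r t)
      finally show "a \<otimes> p \<otimes> s \<oplus> r \<otimes> t \<otimes> t \<otimes> p \<otimes> s
          = p \<oplus> p \<otimes> p \<oplus> r \<otimes> t \<otimes> t \<otimes> p \<otimes> s" .
    qed simp_all
  qed (simp_all add: s_unit a_unit one_plus sa as at sta)
  then show ?thesis by (simp add: a_def rts numeral_2_eq_2)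
qed

section \<open>The relations in the quotient ring\<close>

text \<open>Modulo \<open>t\<^bsup>n+1\<^esup>\<close> this says that the geometric sum is fixed under \<open>x \<mapsto> t + x t\<close> and
  under \<open>x \<mapsto> t + t x\<close>.\<close>

lemma geometric_sum_recurrence:
  fixes t :: "'a::ring_1"
  shows "t + (\<Sum>i=1..n. t ^ i) * t = (\<Sum>i=1..n. t ^ i) + t ^ (n + 1)"
    and "t + t * (\<Sum>i=1..n. t ^ i) = (\<Sum>i=1..n. t ^ i) + t ^ (n + 1)"
  by (induction n) (simp_all add: algebra_simps power_commutes)

definition proj :: "nat \<Rightarrow> free_alg \<Rightarrow> free_alg set"
  where "proj n x = relator_ideal n +>\<^bsub>free_ring\<^esub> x"

lemma proj_simps:
  "proj n x \<in> carrier (S_ring n)"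
  "proj n (x * y) = proj n x \<otimes>\<^bsub>S_ring n\<^esub> proj n y"
  "proj n (x + y) = proj n x \<oplus>\<^bsub>S_ring n\<^esub> proj n y"
  "proj n 1 = \<one>\<^bsub>S_ring n\<^esub>"
proof -
  have hom: "proj n \<in> ring_hom free_ring (S_ring n)"
    using ideal.rcos_ring_hom[OF ideal_relator_ideal] by (simp add: proj_def[abs_def] S_ring_def)
  show "proj n x \<in> carrier (S_ring n)"
    "proj n (x * y) = proj n x \<otimes>\<^bsub>S_ring n\<^esub> proj n y"
    "proj n (x + y) = proj n x \<oplus>\<^bsub>S_ring n\<^esub> proj n y"
    "proj n 1 = \<one>\<^bsub>S_ring n\<^esub>"
    using ring_hom_closed[OF hom, of x] ring_hom_mult[OF hom, of x y]
      ring_hom_add[OF hom, of x y] ring_hom_one[OF hom]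
    by (simp_all add: free_ring_def)
qed

lemma proj_eqI:
  assumes "x - y \<in> relators n"
  shows "proj n x = proj n y"
proof -
  interpret F: ring free_ring by (rule ring_free_ring)
  have "(- y) \<oplus>\<^bsub>free_ring\<^esub> y = \<zero>\<^bsub>free_ring\<^esub>" by (simp add: free_ring_def)
  then have "\<ominus>\<^bsub>free_ring\<^esub> y = - y"
    by (intro F.minus_equality) (simp_all add: free_ring_def)
  then have "x \<ominus>\<^bsub>free_ring\<^esub> y = x - y"
    by (simp add: a_minus_def) (simp add: free_ring_def)
  moreover have "x - y \<in> relator_ideal n"
    using assms F.genideal_self[of "relators n"] by (auto simp: relator_ideal_def free_ring_def)
  ultimately show ?thesis
    using F.quotient_eq_iff_same_a_r_cos[OF ideal_relator_ideal, of x y]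
    by (simp add: proj_def free_ring_def)
qed

theorem proposition3p1:
  fixes n :: nat
  shows "semiquandle (carrier (S_ring n))
    (\<lambda>x y. S_s n \<otimes>\<^bsub>S_ring n\<^esub> x \<oplus>\<^bsub>S_ring n\<^esub> S_t n \<otimes>\<^bsub>S_ring n\<^esub> y)
    (\<lambda>x y. (S_sinv n \<otimes>\<^bsub>S_ring n\<^esub> (\<one>\<^bsub>S_ring n\<^esub> \<ominus>\<^bsub>S_ring n\<^esub> S_t n [^]\<^bsub>S_ring n\<^esub> (2::nat))) \<otimes>\<^bsub>S_ring n\<^esub> x
      \<ominus>\<^bsub>S_ring n\<^esub> (S_sinv n \<otimes>\<^bsub>S_ring n\<^esub> S_t n \<otimes>\<^bsub>S_ring n\<^esub> S_s n) \<otimes>\<^bsub>S_ring n\<^esub> y)"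
proof -
  let ?t = "var Gen_t"
  define p where "p = (\<Sum>i=1..n. ?t ^ i)"
  have img: "image_of n g = proj n (var g)" for g
    by (simp add: image_of_def proj_def)
  have nil: "proj n (p + ?t ^ (n + 1)) = proj n p"
    by (rule proj_eqI) (simp add: relators_def Let_def)
  show ?thesis unfolding img
  proof (rule ring.twisted_semiquandle[OF ring_S_ring, where p = "proj n p"])
    show "proj n (var Gen_s) \<otimes>\<^bsub>S_ring n\<^esub> proj n (var Gen_sbar) = \<one>\<^bsub>S_ring n\<^esub>"
      unfolding proj_simps(2-4)[symmetric] by (rule proj_eqI) (simp add: relators_def Let_def)
    show "proj n (var Gen_sbar) \<otimes>\<^bsub>S_ring n\<^esub> proj n (var Gen_s) = \<one>\<^bsub>S_ring n\<^esub>"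
      unfolding proj_simps(2-4)[symmetric] by (rule proj_eqI) (simp add: relators_def Let_def)
    show "proj n ?t \<otimes>\<^bsub>S_ring n\<^esub> proj n (var Gen_s) = proj n (var Gen_s) \<otimes>\<^bsub>S_ring n\<^esub> proj n p"
      unfolding proj_simps(2-4)[symmetric] by (rule proj_eqI) (simp add: relators_def Let_def p_def)
    show "proj n p = proj n ?t \<oplus>\<^bsub>S_ring n\<^esub> proj n p \<otimes>\<^bsub>S_ring n\<^esub> proj n ?t"
      using nil geometric_sum_recurrence(1)[of ?t n] by (simp add: proj_simps(2,3)[symmetric] p_def)
    show "proj n p = proj n ?t \<oplus>\<^bsub>S_ring n\<^esub> proj n ?t \<otimes>\<^bsub>S_ring n\<^esub> proj n p"
      using nil geometric_sum_recurrence(2)[of ?t n] by (simp add: proj_simps(2,3)[symmetric] p_def)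
  qed (rule proj_simps)+
qed

end
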